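(* Let $\Omega\subset\mathbb{R}^2$ be a bounded smooth domain containing the origin (for the analysis near the origin, the unit ball $B_1$), and let $\Gamma=\Gamma_1\cup\dots\cup\Gamma_m\subset\Omega$, $m\ge1$, be a finite collection of curves (cracks), each passing through the origin. Let the cracks $\Gamma_1,\dots,\Gamma_m$ be asymptotically given, near the origin in the lower half-plane $\{y<0\}$, by $m$ different straight lines: $$\Gamma_k:\quad x=\alpha_k(-y)(1+o(1)),\quad y\to0,\qquad k=1,\dots,m,\qquad \alpha_1<\alpha_2<\dots<\alpha_m .$$ Consider the multiple crack problem $$\Delta u=0\ \text{ in }\Omega,\qquad u=f\ (\not\equiv0)\ \text{ on }\partial\Omega,\qquad u=0\ \text{ on }\Gamma .$$ Then the following hold. (i) If all $\{\alpha_k\}$ do not coincide with all $m$ subsequent zeros of any non-trivial linear combination $$c_l\,\psi^*_{l,1}(z)+d_l\,\psi^*_{l-1,2}(z),\qquad c_l^2+d_l^2\neq0,\qquad z=x/(-y),$$ of the two families of (re-written harmonic) polynomials $\psi^*_{l,1}(z)$ and $\psi^*_{l-1,2}(z)$ defined in the context, for any $l=m,m+1,\dots$ and arbitrary constants $c_l,d_l\in\mathbb{R}$, then the multiple crack problem cannot have a solution for any boundary Dirichlet data $f$ on $\partial\Omega$. (ii) If, for some $l$, the distribution of zeros in (i) holds (that is, the $\{\alpha_k\}$ do coincide with $m$ subsequent zeros of such a non-trivial linear combination with index $l$) and a solution $u(x,y)$ exists, then $$|u(x,y)|=O(|(x,y)|^{l})\quad\text{as }(x,y)\to(0,0).$$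
   Context: Polynomials. With $z=x/(-y)$, consider the quadratic pencil $$(1+z^2)\psi''+2(\lambda+1)z\psi'+\lambda(\lambda+1)\psi=0,$$ with the two families of eigenvalues $\lambda_l^+=-l$ ($l=1,2,\dots$) and $\lambda_l^-=-l-1$ ($l=0,1,2,\dots$). The eigenfunctions are polynomials of degree $l$ $$\psi_l^*(z)=z^l+a_{l-2}z^{l-2}+a_{l-4}z^{l-4}+\cdots,\qquad a_l=1,$$ whose coefficients satisfy $$a_{k+2}=-\frac{k(k-1)+2(\lambda_l^\pm+1)k+\lambda_l^\pm(\lambda_l^\pm+1)}{(k+2)(k+1)}\,a_k,\quad k=l,l-2,\dots,2,$$ $$a_1=-\frac{6}{2(\lambda_l^\pm+1)+\lambda_l^\pm(\lambda_l^\pm+1)}\,a_3,\qquad a_0=-\frac{2}{\lambda_l^\pm(\lambda_l^\pm+1)}\,a_2 .$$ Here $\psi^*_{l,1}$ denotes the eigenfunction of degree $l$ for the eigenvalue $\lambda_l^+=-l$, and $\psi^*_{l-1,2}$ the eigenfunction of degree $l-1$ for the eigenvalue $\lambda_{l-1}^-=-l$; so both correspond to $\lambda=-l$. Up to constant factors, the first ones are: for $\lambda=-1$: $z$, $1$; for $\lambda=-2$: $z^2-1$, $z$; for $\lambda=-3$: $z^3-3z$, $3z^2-1$; for $\lambda=-4$: $z^4-6z^2+1$, $z^3-z$.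
   Formalization: In (i) the "m subsequent zeros" may have other zeros in between; in (ii), l must be the first index ≥ m for which the α_k are zeros of such a combination, or m ≥ 2 and the zeros are consecutive. Otherwise the claims fail (e.g. m=1, α_1=0, l=3, u=x). *)

theory Defs
  imports
    "HOL-Analysis.Analysis"
    "HOL-Library.Landau_Symbols"
    "HOL-Computational_Algebra.Polynomial"
begin

section \<open>Classical smoothness and the Laplacian\<close>

definition partial :: "'a::euclidean_space \<Rightarrow> ('a \<Rightarrow> real) \<Rightarrow> 'a \<Rightarrow> real" where
  "partial b f p = frechet_derivative f (at p) b"

text \<open>
  Meant for open \<open>S\<close>; \<open>Ck_on k f S\<close> is then the usual class of \<open>k\<close> times continuously
  differentiable functions.
\<close>

primrec Ck_on :: "nat \<Rightarrow> ('a::euclidean_space \<Rightarrow> real) \<Rightarrow> 'a set \<Rightarrow> bool" where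
  "Ck_on 0 f S \<longleftrightarrow> continuous_on S f"
| "Ck_on (Suc k) f S \<longleftrightarrow>
     (\<forall>p\<in>S. f differentiable at p) \<and> (\<forall>b\<in>Basis. Ck_on k (partial b f) S)"

definition laplacian :: "('a::euclidean_space \<Rightarrow> real) \<Rightarrow> 'a \<Rightarrow> real" where
  "laplacian f p = (\<Sum>b\<in>Basis. partial b (partial b f) p)"

text \<open>Near each boundary point the domain is the sublevel set of a smooth regular function.\<close>

definition smooth_boundary :: "'a::euclidean_space set \<Rightarrow> bool" where
  "smooth_boundary \<Omega> \<longleftrightarrow>
     (\<forall>p\<in>frontier \<Omega>. \<exists>U \<rho>. open U \<and> p \<in> U \<and> (\<forall>k. Ck_on k \<rho> U) \<and>
        (\<forall>q\<in>U. \<exists>b\<in>Basis. partial b \<rho> q \<noteq> 0) \<and>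
        \<Omega> \<inter> U = {q \<in> U. \<rho> q < 0} \<and> frontier \<Omega> \<inter> U = {q \<in> U. \<rho> q = 0})"

definition bounded_smooth_domain :: "'a::euclidean_space set \<Rightarrow> bool" where
  "bounded_smooth_domain \<Omega> \<longleftrightarrow>
     open \<Omega> \<and> connected \<Omega> \<and> \<Omega> \<noteq> {} \<and> bounded \<Omega> \<and> smooth_boundary \<Omega>"

section \<open>Cracks and the crack problem\<close>

text \<open>The parameter interval need not be compact, so a crack may run up to the boundary.\<close>

definition is_curve :: "'a::topological_space set \<Rightarrow> bool" where
  "is_curve C \<longleftrightarrow> (\<exists>(I::real set) g. is_interval I \<and> continuous_on I g \<and> C = g ` I)"

abbreviation lower_half_plane :: "(real \<times> real) set" where
  "lower_half_plane \<equiv> {p. snd p < 0}"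

text \<open>
  The relation \<open>x = a (-y) (1 + o(1))\<close> along the part of \<open>C\<close> in the lower half-plane, read as
  \<open>x / (-y) \<longlongrightarrow> a\<close>. For \<open>a \<noteq> 0\<close> this is the same thing; for \<open>a = 0\<close> it says \<open>x = o(-y)\<close> instead
  of forcing \<open>x = 0\<close>. The first conjunct says that \<open>C\<close> does reach the origin from below.
\<close>

definition asymptotic_line_below :: "(real \<times> real) set \<Rightarrow> real \<Rightarrow> bool" where
  "asymptotic_line_below C a \<longleftrightarrow>
     (0, 0) islimpt (C \<inter> lower_half_plane) \<and>
     ((\<lambda>(x, y). x / (- y)) \<longlongrightarrow> a) (at (0, 0) within (C \<inter> lower_half_plane))"

text \<open>
  Classical solutions. The equation holds in all of \<open>\<Omega>\<close>, also across the crack set \<open>G\<close>, so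
  the condition on \<open>G\<close> overdetermines the Dirichlet problem.
\<close>

definition crack_solution ::
  "'a::euclidean_space set \<Rightarrow> 'a set \<Rightarrow> ('a \<Rightarrow> real) \<Rightarrow> ('a \<Rightarrow> real) \<Rightarrow> bool" where
  "crack_solution \<Omega> G f u \<longleftrightarrow>
     continuous_on (closure \<Omega>) u \<and> Ck_on 2 u \<Omega> \<and>
     (\<forall>p\<in>\<Omega>. laplacian u p = 0) \<and>
     (\<forall>p\<in>frontier \<Omega>. u p = f p) \<and>
     (\<forall>p\<in>G. u p = 0)"

section \<open>Eigenfunctions of the quadratic pencil\<close>

text \<open>
  \<open>pencil_coeff lam l j\<close> is the coefficient \<open>a\<^bsub>l-2j\<^esub>\<close> of the monic eigenfunction of degree \<open>l\<close>:
  with \<open>k = l - 2(j+1)\<close>, the recursion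
  \<open>a\<^bsub>k+2\<^esub> = - (k(k-1) + 2(lam+1)k + lam(lam+1)) / ((k+2)(k+1)) a\<^bsub>k\<^esub>\<close> is solved for \<open>a\<^bsub>k\<^esub>\<close>.
  The numerator is \<open>(k+lam)(k+lam+1)\<close>, nonzero for \<open>k < l - 1\<close> when \<open>lam\<close> is \<open>-l\<close> or \<open>-l-1\<close>.
  The special formulas for \<open>a\<^sub>1\<close> and \<open>a\<^sub>0\<close> are the cases \<open>k = 1\<close> and \<open>k = 0\<close>.
\<close>

primrec pencil_coeff :: "real \<Rightarrow> nat \<Rightarrow> nat \<Rightarrow> real" where
  "pencil_coeff lam l 0 = 1"
| "pencil_coeff lam l (Suc j) =
     (let k = real l - 2 * real (Suc j) in
        - ((k + 2) * (k + 1)) / (k * (k - 1) + 2 * (lam + 1) * k + lam * (lam + 1))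
          * pencil_coeff lam l j)"

definition pencil_poly :: "real \<Rightarrow> nat \<Rightarrow> real poly" where
  "pencil_poly lam l = (\<Sum>j\<le>l div 2. monom (pencil_coeff lam l j) (l - 2 * j))"

definition psi1 :: "nat \<Rightarrow> real poly" where
  "psi1 l = pencil_poly (- real l) l"

definition psi2 :: "nat \<Rightarrow> real poly" where
  "psi2 l = pencil_poly (- real l - 1) l"

definition psi_comb :: "nat \<Rightarrow> real \<Rightarrow> real \<Rightarrow> real poly" where
  "psi_comb l c d = smult c (psi1 l) + smult d (psi2 (l - 1))"

text \<open>
  Here the zeros are listed in increasing order, but other zeros may lie in between: if the
  cracks are only some of the nodal lines of a harmonic polynomial, neighbouring or not, that
  polynomial solves the crack problem.
\<close>

definition coincide_with_zeros :: "nat \<Rightarrow> (nat \<Rightarrow> real) \<Rightarrow> nat \<Rightarrow> bool" where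
  "coincide_with_zeros m \<alpha> l \<longleftrightarrow>
     (\<exists>c d. c\<^sup>2 + d\<^sup>2 \<noteq> 0 \<and> (\<forall>k\<in>{1..m}. poly (psi_comb l c d) (\<alpha> k) = 0))"

definition coincide_with_consecutive_zeros :: "nat \<Rightarrow> (nat \<Rightarrow> real) \<Rightarrow> nat \<Rightarrow> bool" where
  "coincide_with_consecutive_zeros m \<alpha> l \<longleftrightarrow>
     (\<exists>c d. c\<^sup>2 + d\<^sup>2 \<noteq> 0 \<and> (\<forall>k\<in>{1..m}. poly (psi_comb l c d) (\<alpha> k) = 0) \<and>
        (\<forall>k\<in>{1..<m}. \<forall>z. \<alpha> k < z \<and> z < \<alpha> (Suc k) \<longrightarrow> poly (psi_comb l c d) z \<noteq> 0))"

end

theory Submission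
  imports Defs "HOL-Complex_Analysis.Complex_Analysis"
begin

text \<open>
  A solution \<open>u\<close> is harmonic in a full neighbourhood of the origin, also across the cracks.
  So near the origin it is the real part of a holomorphic function, and either \<open>u\<close> vanishes
  on all of \<open>\<Omega>\<close>, which the boundary data forbid, or
  \<open>u = Re (w\<^sup>N h(w))\<close> with \<open>w = x + i y\<close>, \<open>N \<ge> 1\<close> and \<open>C = h(0) \<noteq> 0\<close>
  (\<open>harmonic_local_factorization\<close>). Here \<open>N\<close> is the exact order of vanishing, so
  \<open>u = O(\<bar>w\<bar>\<^sup>l)\<close> for all \<open>l \<le> N\<close>.

  With \<open>z = x / (-y)\<close> one has \<open>w = (-y) (z - i)\<close> for \<open>y < 0\<close>. Dividing the condition \<open>u = 0\<close> on
  a crack by \<open>(-y)\<^sup>N\<close> and passing to the origin gives \<open>Re (C (\<alpha>\<^sub>k - i)\<^sup>N) = 0\<close>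
  (\<open>nodal_direction_zero\<close>). Up to constants, the two pencil polynomials for \<open>\<lambda> = -N\<close> are the real
  and the imaginary part of \<open>(z - i)\<^sup>N\<close>, by comparison of the coefficient recursion with the
  binomial theorem. So the \<open>\<alpha>\<^sub>k\<close> are zeros of a non-trivial combination of index \<open>N\<close>
  (\<open>poly_psi_comb\<close>).

  What is left is to compare \<open>N\<close> with \<open>m\<close> and with \<open>l\<close>. In the angle \<open>arctan z\<close>, which ranges
  over an interval of length \<open>\<pi>\<close>, the zeros of \<open>Re (C (z - i)\<^sup>n)\<close> are those of a cosine of
  frequency \<open>n\<close>, hence they form a grid of mesh \<open>\<pi>/n\<close>. So there are at most \<open>n\<close> of them, whence
  \<open>N \<ge> m\<close>, and this proves the non-existence claim. If \<open>l\<close> is the least index \<open>\<ge> m\<close> for which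
  the \<open>\<alpha>\<^sub>k\<close> are zeros of a combination, then \<open>N \<ge> l\<close> at once. If instead \<open>\<alpha>\<^sub>1\<close> and \<open>\<alpha>\<^sub>2\<close> are
  consecutive zeros for the index \<open>l\<close>, their angles differ by \<open>\<pi>/l\<close>; being distinct zeros for
  the index \<open>N\<close>, they differ by at least \<open>\<pi>/N\<close>; again \<open>N \<ge> l\<close>.
\<close>

section \<open>Symmetry of second derivatives\<close>


lemma directional_derivative_along_line:
  fixes f :: "'a::euclidean_space \<Rightarrow> real"
  assumes "f differentiable at (p + t *\<^sub>R b)"
  shows "((\<lambda>t. f (p + t *\<^sub>R b)) has_real_derivative partial b f (p + t *\<^sub>R b)) (at t)"
proof -
  let ?D = "frechet_derivative f (at (p + t *\<^sub>R b))"
  have D: "(f has_derivative ?D) (at (p + t *\<^sub>R b))"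
    using assms frechet_derivative_works by blast
  then have "((\<lambda>t. f (p + t *\<^sub>R b)) has_derivative (\<lambda>s. ?D (s *\<^sub>R b))) (at t)"
    by (auto intro!: derivative_eq_intros has_derivative_compose[of "\<lambda>t. p + t *\<^sub>R b" _ t UNIV f])
  moreover have "?D (s *\<^sub>R b) = partial b f (p + t *\<^sub>R b) * s" for s
    using has_derivative_linear[OF D] by (simp add: partial_def linear_cmul)
  ultimately show ?thesis
    by (simp add: has_field_derivative_def)
qed

text \<open>
  The mean value theorem is applied twice, first in the direction \<open>a\<close> to the difference of \<open>f\<close>
  along two parallel edges, then in the direction \<open>b\<close>. The left-hand side is symmetric in \<open>a\<close>
  and \<open>b\<close>, which is what makes the mixed derivatives agree.
\<close>

lemma second_difference_mean_value:
  fixes f :: "'a::euclidean_space \<Rightarrow> real"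
  assumes "h > 0"
    and f: "\<And>s t. \<lbrakk>0 \<le> s; s \<le> h; 0 \<le> t; t \<le> h\<rbrakk>
              \<Longrightarrow> f differentiable at (p + s *\<^sub>R a + t *\<^sub>R b)"
    and fa: "\<And>s t. \<lbrakk>0 \<le> s; s \<le> h; 0 \<le> t; t \<le> h\<rbrakk>
              \<Longrightarrow> partial a f differentiable at (p + s *\<^sub>R a + t *\<^sub>R b)"
  obtains s t where "0 < s" "s < h" "0 < t" "t < h"
    "f (p + h *\<^sub>R a + h *\<^sub>R b) - f (p + h *\<^sub>R a) - f (p + h *\<^sub>R b) + f p
       = h\<^sup>2 * partial b (partial a f) (p + s *\<^sub>R a + t *\<^sub>R b)"
proof -
  define \<phi> where "\<phi> s = f ((p + h *\<^sub>R b) + s *\<^sub>R a) - f (p + s *\<^sub>R a)" for s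
  have "(\<phi> has_real_derivative partial a f ((p + h *\<^sub>R b) + s *\<^sub>R a) - partial a f (p + s *\<^sub>R a)) (at s)"
    if "0 \<le> s" "s \<le> h" for s
    unfolding \<phi>_def
    using f[of s h] f[of s 0] that \<open>h > 0\<close>
    by (intro derivative_intros directional_derivative_along_line) (auto simp: algebra_simps)
  from MVT2[OF \<open>h > 0\<close> this] obtain s where s: "0 < s" "s < h"
    "\<phi> h - \<phi> 0 = h * (partial a f ((p + h *\<^sub>R b) + s *\<^sub>R a) - partial a f (p + s *\<^sub>R a))"
    by auto
  have "((\<lambda>t. partial a f ((p + s *\<^sub>R a) + t *\<^sub>R b)) has_real_derivative
          partial b (partial a f) ((p + s *\<^sub>R a) + t *\<^sub>R b)) (at t)"
    if "0 \<le> t" "t \<le> h" for t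
    using fa[of s t] that s by (intro directional_derivative_along_line) auto
  from MVT2[OF \<open>h > 0\<close> this] obtain t where t: "0 < t" "t < h"
    "partial a f ((p + s *\<^sub>R a) + h *\<^sub>R b) - partial a f (p + s *\<^sub>R a)
       = h * partial b (partial a f) ((p + s *\<^sub>R a) + t *\<^sub>R b)"
    by auto
  have "f (p + h *\<^sub>R a + h *\<^sub>R b) - f (p + h *\<^sub>R a) - f (p + h *\<^sub>R b) + f p = \<phi> h - \<phi> 0"
    by (simp add: \<phi>_def algebra_simps)
  also have "\<dots> = h\<^sup>2 * partial b (partial a f) (p + s *\<^sub>R a + t *\<^sub>R b)"
    using s(3) t(3) by (simp add: add_ac power2_eq_square)
  finally show thesis
    using that s t by blast
qed

lemma mixed_partials_commute:
  fixes f :: "'a::euclidean_space \<Rightarrow> real"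
  assumes S: "open S" "p \<in> S"
    and f: "\<And>q. q \<in> S \<Longrightarrow> f differentiable at q"
    and fa: "\<And>q. q \<in> S \<Longrightarrow> partial a f differentiable at q"
    and fb: "\<And>q. q \<in> S \<Longrightarrow> partial b f differentiable at q"
    and fab: "continuous_on S (partial b (partial a f))"
    and fba: "continuous_on S (partial a (partial b f))"
  shows "partial b (partial a f) p = partial a (partial b f) p"
proof (rule ccontr)
  let ?A = "partial b (partial a f)" and ?B = "partial a (partial b f)"
  assume ne: "?A p \<noteq> ?B p"
  \<comment> \<open>Half of the distance: two values within \<open>e\<close> of \<open>?A p\<close> and of \<open>?B p\<close> cannot be equal.\<close>
  define e where "e = \<bar>?A p - ?B p\<bar> / 2"
  have "e > 0" using ne by (simp add: e_def)
  have "isCont ?A p" "isCont ?B p"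
    using fab fba S continuous_on_eq_continuous_at by blast+
  then obtain d1 d2 where d: "d1 > 0" "d2 > 0"
    "\<And>q. dist q p < d1 \<Longrightarrow> \<bar>?A q - ?A p\<bar> < e" "\<And>q. dist q p < d2 \<Longrightarrow> \<bar>?B q - ?B p\<bar> < e"
    using \<open>e > 0\<close> unfolding continuous_at_eps_delta by (metis dist_real_def)
  obtain d3 where d3: "d3 > 0" "ball p d3 \<subseteq> S"
    using S openE by blast
  define d where "d = min d1 (min d2 d3)"
  \<comment> \<open>So small that the whole parallelogram with sides \<open>h a\<close> and \<open>h b\<close> stays within \<open>d\<close> of \<open>p\<close>.\<close>
  define h where "h = d / (1 + norm a + norm b)"
  have pos: "1 + norm a + norm b > 0"
    by (smt (verit) norm_ge_zero)
  have "d > 0" using d d3 by (simp add: d_def)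
  then have "h > 0" using pos by (simp add: h_def)
  have near: "dist (p + s *\<^sub>R a + t *\<^sub>R b) p < d"
    if "0 \<le> s" "s \<le> h" "0 \<le> t" "t \<le> h" for s t
  proof -
    have "dist (p + s *\<^sub>R a + t *\<^sub>R b) p = norm (s *\<^sub>R a + t *\<^sub>R b)"
      by (simp add: dist_norm add.assoc)
    also have "\<dots> \<le> s * norm a + t * norm b"
      using that by (metis abs_of_nonneg norm_scaleR norm_triangle_ineq)
    also have "\<dots> \<le> h * norm a + h * norm b"
      using that by (intro add_mono mult_right_mono) auto
    also have "\<dots> < h * (1 + norm a + norm b)"
      using \<open>h > 0\<close> by (simp add: algebra_simps)
    also have "\<dots> = d"
      using pos by (simp add: h_def)
    finally show ?thesis .
  qed
  have inS: "p + s *\<^sub>R a + t *\<^sub>R b \<in> S"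
    if "0 \<le> s" "s \<le> h" "0 \<le> t" "t \<le> h" for s t
    using near[OF that] d3 by (auto simp: d_def dist_commute)
  obtain s t where st: "0 < s" "s < h" "0 < t" "t < h"
    "f (p + h *\<^sub>R a + h *\<^sub>R b) - f (p + h *\<^sub>R a) - f (p + h *\<^sub>R b) + f p
       = h\<^sup>2 * ?A (p + s *\<^sub>R a + t *\<^sub>R b)"
    by (rule second_difference_mean_value[of h f p a b]) (use \<open>h > 0\<close> f fa inS in auto)
  have inS': "p + t *\<^sub>R b + s *\<^sub>R a \<in> S"
    if "0 \<le> s" "s \<le> h" "0 \<le> t" "t \<le> h" for s t
    using inS[OF that] by (simp add: add_ac)
  obtain t' s' where st': "0 < t'" "t' < h" "0 < s'" "s' < h"
    "f (p + h *\<^sub>R b + h *\<^sub>R a) - f (p + h *\<^sub>R b) - f (p + h *\<^sub>R a) + f p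
       = h\<^sup>2 * ?B (p + t' *\<^sub>R b + s' *\<^sub>R a)"
    by (rule second_difference_mean_value[of h f p b a]) (use \<open>h > 0\<close> f fb inS' in auto)
  have swap: "p + x *\<^sub>R b + y *\<^sub>R a = p + y *\<^sub>R a + x *\<^sub>R b" for x y
    by simp
  have "h\<^sup>2 * ?A (p + s *\<^sub>R a + t *\<^sub>R b) = h\<^sup>2 * ?B (p + s' *\<^sub>R a + t' *\<^sub>R b)"
    using st(5) st'(5) unfolding swap by linarith
  then have eq: "?A (p + s *\<^sub>R a + t *\<^sub>R b) = ?B (p + s' *\<^sub>R a + t' *\<^sub>R b)"
    using \<open>h > 0\<close> by simp
  have "\<bar>?A (p + s *\<^sub>R a + t *\<^sub>R b) - ?A p\<bar> < e" "\<bar>?B (p + s' *\<^sub>R a + t' *\<^sub>R b) - ?B p\<bar> < e"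
    using near[of s t] near[of s' t'] st st' d by (auto simp: d_def)
  then show False
    using eq unfolding e_def by (smt (verit) field_sum_of_halves)
qed

section \<open>Harmonic functions as real parts of holomorphic functions\<close>

lemma has_derivative_partials:
  fixes f :: "real \<times> real \<Rightarrow> real"
  assumes "f differentiable at p"
  shows "(f has_derivative (\<lambda>v. fst v * partial (1, 0) f p + snd v * partial (0, 1) f p)) (at p)"
proof -
  let ?D = "frechet_derivative f (at p)"
  have D: "(f has_derivative ?D) (at p)"
    using assms frechet_derivative_works by blast
  have "?D v = fst v * partial (1, 0) f p + snd v * partial (0, 1) f p" for v
  proof -
    have "v = fst v *\<^sub>R (1, 0) + snd v *\<^sub>R (0, 1)" by (simp add: prod_eq_iff)
    then have "?D v = ?D (fst v *\<^sub>R (1, 0)) + ?D (snd v *\<^sub>R (0, 1))"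
      using has_derivative_linear[OF D] linear_add by metis
    then show ?thesis
      using has_derivative_linear[OF D] by (simp only: linear_cmul partial_def real_scaleR_def)
  qed
  then show ?thesis using D by (metis (no_types, lifting) ext)
qed

lemma has_derivative_partials_complex:
  fixes f :: "real \<times> real \<Rightarrow> real"
  assumes "f differentiable at (Re z, Im z)"
  shows "((\<lambda>w. f (Re w, Im w)) has_derivative
    (\<lambda>v. Re v * partial (1, 0) f (Re z, Im z) + Im v * partial (0, 1) f (Re z, Im z))) (at z)"
proof -
  have "((\<lambda>w. (Re w, Im w)) has_derivative (\<lambda>v. (Re v, Im v))) (at z)"
    by (auto intro!: derivative_eq_intros)
  from has_derivative_compose[OF this has_derivative_partials[OF assms]]
  show ?thesis by simp
qed

lemma Basis_real_prod: "(Basis :: (real \<times> real) set) = {(1, 0), (0, 1)}"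
  by (auto simp: Basis_prod_def)

text \<open>
  For \<open>u\<^sub>x - i u\<^sub>y\<close>, one Cauchy-Riemann equation is the Laplace equation and the other one is
  the symmetry of the second derivatives. Unlike a harmonic conjugate, this function always
  exists on the whole domain, and so analytic continuation applies to it there.
\<close>

lemma harmonic_gradient_holomorphic:
  fixes u :: "real \<times> real \<Rightarrow> real"
  assumes \<Omega>: "open \<Omega>" and C2: "Ck_on 2 u \<Omega>" and harm: "\<forall>p\<in>\<Omega>. laplacian u p = 0"
  shows "(\<lambda>w. Complex (partial (1, 0) u (Re w, Im w)) (- partial (0, 1) u (Re w, Im w)))
           holomorphic_on {w. (Re w, Im w) \<in> \<Omega>}"
    (is "?g holomorphic_on ?S")
proof -
  let ?U = "partial (1, 0) u" and ?V = "partial (0, 1) u"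
  have reg: "\<And>q. q \<in> \<Omega> \<Longrightarrow> u differentiable at q"
    "\<And>q. q \<in> \<Omega> \<Longrightarrow> ?U differentiable at q" "\<And>q. q \<in> \<Omega> \<Longrightarrow> ?V differentiable at q"
    "continuous_on \<Omega> (partial (0, 1) ?U)" "continuous_on \<Omega> (partial (1, 0) ?V)"
    using C2 by (auto simp: numeral_2_eq_2 Basis_real_prod)
  have "?g field_differentiable at z" if z: "(Re z, Im z) \<in> \<Omega>" for z
  proof -
    let ?p = "(Re z, Im z)"
    let ?A = "partial (1, 0) ?U ?p" and ?B = "partial (0, 1) ?U ?p"
    have sym: "partial (1, 0) ?V ?p = ?B"
      using mixed_partials_commute[OF \<Omega> z reg] by simp
    have lap: "partial (0, 1) ?V ?p = - ?A"
      using harm z by (auto simp: laplacian_def Basis_real_prod)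
    have "((\<lambda>w. of_real (?U (Re w, Im w)) - \<i> * of_real (?V (Re w, Im w))) has_derivative
        (\<lambda>v. of_real (Re v * ?A + Im v * ?B) - \<i> * of_real (Re v * ?B + Im v * (- ?A)))) (at z)"
      using has_derivative_partials_complex[OF reg(2)[OF z]]
        has_derivative_partials_complex[OF reg(3)[OF z]]
      unfolding sym lap
      by (intro derivative_intros) auto
    moreover have "(\<lambda>v. of_real (Re v * ?A + Im v * ?B) - \<i> * of_real (Re v * ?B + Im v * (- ?A)))
        = (*) (Complex ?A (- ?B))"
      by (auto simp: complex_eq_iff algebra_simps)
    moreover have "(\<lambda>w. of_real (?U (Re w, Im w)) - \<i> * of_real (?V (Re w, Im w))) = ?g"
      by (auto simp: complex_eq_iff)
    ultimately show ?thesis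
      unfolding field_differentiable_def has_field_derivative_def by metis
  qed
  then show ?thesis
    unfolding holomorphic_on_def using field_differentiable_at_within by blast
qed

text \<open>
  On a disc, \<open>u\<^sub>x - i u\<^sub>y\<close> has a primitive, whose real part has the same gradient as \<open>u\<close>. If this
  primitive were constant, the gradient of \<open>u\<close> would vanish on the disc, and by analytic
  continuation on all of the connected set \<open>\<Omega>\<close>, so that \<open>u\<close> would be identically \<open>0\<close>.
\<close>

lemma harmonic_local_factorization:
  fixes u :: "real \<times> real \<Rightarrow> real"
  assumes \<Omega>: "open \<Omega>" "connected \<Omega>" "(0, 0) \<in> \<Omega>"
    and C2: "Ck_on 2 u \<Omega>" and harm: "\<forall>p\<in>\<Omega>. laplacian u p = 0"
    and u0: "u (0, 0) = 0" and nz: "\<exists>p\<in>\<Omega>. u p \<noteq> 0"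
  obtains N r h where "N > 0" "r > 0" "h holomorphic_on ball 0 r" "h 0 \<noteq> 0"
    "\<And>w. w \<in> ball 0 r \<Longrightarrow> u (Re w, Im w) = Re (w ^ N * h w)"
proof -
  define S where "S = {w. (Re w, Im w) \<in> \<Omega>}"
  define g where "g w = Complex (partial (1, 0) u (Re w, Im w)) (- partial (0, 1) u (Re w, Im w))" for w
  have S_vimage: "S = (\<lambda>w. (Re w, Im w)) -` \<Omega>"
    by (auto simp: S_def)
  have "open S"
    unfolding S_vimage by (intro open_vimage \<Omega> continuous_intros)
  have S_image: "S = (\<lambda>p. of_real (fst p) + \<i> * of_real (snd p)) ` \<Omega>"
    by (force simp: S_def complex_eq_iff image_iff)
  have "connected S"
    unfolding S_image by (intro connected_continuous_image \<Omega> continuous_intros)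
  have "0 \<in> S" using \<Omega> by (simp add: S_def)
  have g: "g holomorphic_on S"
    using harmonic_gradient_holomorphic[OF \<Omega>(1) C2 harm] by (simp add: g_def [abs_def] S_def)
  have du: "((\<lambda>w. u (Re w, Im w)) has_derivative (\<lambda>v. Re (g w * v))) (at w)" if "w \<in> S" for w
  proof -
    have "u differentiable at (Re w, Im w)"
      using C2 that by (auto simp: S_def numeral_2_eq_2)
    from has_derivative_partials_complex[OF this] show ?thesis
      by (simp add: g_def mult.commute)
  qed
  obtain R where R: "R > 0" "ball 0 R \<subseteq> S"
    using \<open>open S\<close> \<open>0 \<in> S\<close> openE by blast
  obtain F0 where F0: "\<And>w. w \<in> ball 0 R \<Longrightarrow> (F0 has_field_derivative g w) (at w)"
    using holomorphic_convex_primitive'[of "ball 0 R" g] holomorphic_on_subset[OF g R(2)]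
    by (metis at_within_open convex_ball open_ball)
  \<comment> \<open>Normalised to vanish at \<open>0\<close>, so that its real part is \<open>u\<close> exactly and \<open>0\<close> can be factored out.\<close>
  define F where "F w = F0 w - F0 0" for w
  have F: "(F has_field_derivative g w) (at w)" if "w \<in> ball 0 R" for w
    unfolding F_def using F0[OF that] by (auto intro!: derivative_eq_intros)
  have F_hol: "F holomorphic_on ball 0 R"
    using F holomorphic_on_open open_ball by blast
  have u_eq: "u (Re w, Im w) = Re (F w)" if w: "w \<in> ball 0 R" for w
  proof -
    have D: "((\<lambda>w. u (Re w, Im w) - Re (F w)) has_derivative (\<lambda>v. 0)) (at w)"
      if "w \<in> ball 0 R" for w
    proof -
      have "((\<lambda>w. Re (F w)) has_derivative (\<lambda>v. Re (g w * v))) (at w)"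
        using F[OF that] unfolding has_field_derivative_def by (rule has_derivative_Re)
      from has_derivative_diff[OF du this] that R show ?thesis by auto
    qed
    have "u (Re w, Im w) - Re (F w) = u (Re 0, Im 0) - Re (F 0)"
      by (rule has_derivative_zero_unique_connected[of "ball 0 R"])
        (use D w R in auto)
    then show ?thesis using u0 by (simp add: F_def)
  qed
  have nonconst: "\<not> F constant_on ball 0 R"
  proof
    assume "F constant_on ball 0 R"
    then obtain c where c: "\<And>w. w \<in> ball 0 R \<Longrightarrow> F w = c"
      by (auto simp: constant_on_def)
    have g0: "g w = 0" if "w \<in> ball 0 R" for w
    proof -
      have "(F has_field_derivative 0) (at w)"
        by (rule has_field_derivative_transform_within_open[of "\<lambda>_. c" _ _ "ball 0 R"])
          (use that c in auto)
      then show ?thesis using F[OF that] DERIV_unique by blast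
    qed
    have g_zero: "g w = 0" if "w \<in> S" for w
      by (rule analytic_continuation_open[of "ball 0 R" S g "\<lambda>_. 0"])
        (use \<open>open S\<close> \<open>connected S\<close> R g g0 that in auto)
    have "u (Re w, Im w) = u (Re 0, Im 0)" if "w \<in> S" for w
      by (rule has_derivative_zero_unique_connected[OF \<open>open S\<close> \<open>connected S\<close> _ that \<open>0 \<in> S\<close>,
            of "\<lambda>w. u (Re w, Im w)"])
        (use du g_zero in fastforce)
    then have "u (x, y) = 0" if "(x, y) \<in> \<Omega>" for x y
      using that u0 by (metis (mono_tags, lifting) S_def complex.sel mem_Collect_eq zero_complex.sel)
    then show False using nz by auto
  qed
  obtain h r N where "0 < N" "0 < r" "ball 0 r \<subseteq> ball (0::complex) R" "h holomorphic_on ball 0 r"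
    "\<And>w. w \<in> ball 0 r \<Longrightarrow> F w = (w - 0) ^ N * h w" "\<And>w. w \<in> ball 0 r \<Longrightarrow> h w \<noteq> 0"
    by (rule holomorphic_factor_zero_nonconstant[OF F_hol open_ball connected_ball, of 0])
      (use R nonconst F_def in auto)
  with u_eq show thesis
    by (intro that[of N r h]) auto
qed

section \<open>The leading term at the origin\<close>

lemma tendsto_Complex_origin:
  "((\<lambda>p. Complex (fst p) (snd p)) \<longlongrightarrow> 0) (at (0, 0) within A)"
proof -
  let ?o = "(0, 0) :: real \<times> real"
  have "((\<lambda>p. Complex (fst p) (snd p)) \<longlongrightarrow> Complex (fst ?o) (snd ?o)) (at ?o within A)"
    by (rule tendsto_Complex[OF tendsto_fst[OF tendsto_ident_at] tendsto_snd[OF tendsto_ident_at]])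
  then show ?thesis by (simp add: zero_complex.code)
qed

lemma tendsto_holomorphic_origin:
  assumes "r > 0" and h: "h holomorphic_on ball 0 r"
  shows "((\<lambda>p. h (Complex (fst p) (snd p))) \<longlongrightarrow> h 0) (at (0, 0) within A)"
proof -
  have "isCont h 0"
    using holomorphic_on_imp_continuous_on[OF h] \<open>r > 0\<close>
    by (simp add: continuous_on_eq_continuous_at[OF open_ball])
  then show ?thesis
    by (rule isCont_tendsto_compose) (rule tendsto_Complex_origin)
qed

text \<open>
  The homogeneity of \<open>w\<^sup>N\<close> turns \<open>u = 0\<close> at a crack point into
  \<open>Re (h(w) (z - i)\<^sup>N) = 0\<close> for the slope \<open>z = x / (-y)\<close>, and this passes to the limit.
\<close>

lemma nodal_direction_zero:
  fixes u :: "real \<times> real \<Rightarrow> real"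
  assumes "r > 0" and h: "h holomorphic_on ball 0 r"
    and u: "\<And>w. w \<in> ball 0 r \<Longrightarrow> u (Re w, Im w) = Re (w ^ N * h w)"
    and G: "asymptotic_line_below G a" and u0: "\<And>p. p \<in> G \<Longrightarrow> u p = 0"
  shows "Re (h 0 * (of_real a - \<i>) ^ N) = 0"
proof -
  let ?F = "at (0, 0) within (G \<inter> lower_half_plane)"
  let ?z = "\<lambda>p :: real \<times> real. fst p / (- snd p)" and ?w = "\<lambda>p. Complex (fst p) (snd p)"
  \<comment> \<open>The crack accumulates at the origin from below, so limits along it are unique.\<close>
  have nontriv: "?F \<noteq> bot"
    using G by (simp add: asymptotic_line_below_def trivial_limit_within)
  have z: "(?z \<longlongrightarrow> a) ?F"
    using G by (simp add: asymptotic_line_below_def case_prod_unfold)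
  note w = tendsto_Complex_origin[of "G \<inter> lower_half_plane"]
  have lim: "((\<lambda>p. Re (h (?w p) * (of_real (?z p) - \<i>) ^ N)) \<longlongrightarrow> Re (h 0 * (of_real a - \<i>) ^ N)) ?F"
    by (intro tendsto_intros tendsto_holomorphic_origin[OF \<open>r > 0\<close> h] z)
  have "eventually (\<lambda>p. ?w p \<in> ball 0 r) ?F"
    using topological_tendstoD[OF w open_ball, of 0 r] \<open>r > 0\<close> by simp
  moreover have "eventually (\<lambda>p. p \<in> G \<inter> lower_half_plane) ?F"
    by (simp add: eventually_at_filter)
  ultimately have "eventually (\<lambda>p. Re (h (?w p) * (of_real (?z p) - \<i>) ^ N) = 0) ?F"
  proof eventually_elim
    case (elim p)
    then have y: "snd p < 0" by auto
    have "?w p = of_real (- snd p) * (of_real (?z p) - \<i>)"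
      using y by (simp add: complex_eq_iff)
    then have "?w p ^ N * h (?w p) = of_real ((- snd p) ^ N) * (h (?w p) * (of_real (?z p) - \<i>) ^ N)"
      by (simp only: power_mult_distrib of_real_power mult_ac)
    then have "(- snd p) ^ N * Re (h (?w p) * (of_real (?z p) - \<i>) ^ N) = Re (?w p ^ N * h (?w p))"
      by (simp only: scaleR_conv_of_real[symmetric] scaleR_complex.sel)
    also have "\<dots> = 0"
      using u[of "?w p"] u0[of p] elim by simp
    finally show ?case using y by simp
  qed
  then have "((\<lambda>p. Re (h (?w p) * (of_real (?z p) - \<i>) ^ N)) \<longlongrightarrow> 0) ?F"
    by (rule tendsto_eventually)
  then show ?thesis
    using tendsto_unique[OF nontriv lim] by simp
qed

lemma factorization_bigo:
  fixes u :: "real \<times> real \<Rightarrow> real"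
  assumes "r > 0" and h: "h holomorphic_on ball 0 r"
    and u: "\<And>w. w \<in> ball 0 r \<Longrightarrow> u (Re w, Im w) = Re (w ^ N * h w)"
    and "l \<le> N"
  shows "u \<in> O[at (0, 0)](\<lambda>p. norm p ^ l)"
proof -
  let ?w = "\<lambda>p. Complex (fst p) (snd p)"
  note w = tendsto_Complex_origin[of UNIV]
  have "eventually (\<lambda>p. dist (h (?w p)) (h 0) < 1) (at (0, 0))"
    by (rule tendstoD[OF tendsto_holomorphic_origin[OF \<open>r > 0\<close> h]]) simp
  moreover have "eventually (\<lambda>p. ?w p \<in> ball 0 r) (at (0, 0))"
    "eventually (\<lambda>p. ?w p \<in> ball 0 1) (at (0, 0))"
    using topological_tendstoD[OF w open_ball, of 0 r] topological_tendstoD[OF w open_ball, of 0 1] \<open>r > 0\<close>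
    by simp_all
  ultimately have "eventually (\<lambda>p. norm (u p) \<le> (norm (h 0) + 1) * norm (norm p ^ l)) (at (0, 0))"
  proof eventually_elim
    case (elim p)
    have norm_w: "norm (?w p) = norm p"
      by (simp add: norm_prod_def cmod_def)
    have "norm (u p) \<le> norm (?w p ^ N * h (?w p))"
      using u[of "?w p"] elim abs_Re_le_cmod[of "?w p ^ N * h (?w p)"] by simp
    also have "\<dots> = norm p ^ N * norm (h (?w p))"
      by (simp only: norm_mult norm_power norm_w)
    also have "\<dots> \<le> norm p ^ l * (norm (h 0) + 1)"
    proof (rule mult_mono)
      show "norm p ^ N \<le> norm p ^ l"
        using elim norm_w \<open>l \<le> N\<close> by (intro power_decreasing) auto
      show "norm (h (?w p)) \<le> norm (h 0) + 1"
        using elim norm_triangle_sub[of "h (?w p)" "h 0"] by (simp add: dist_norm)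
    qed auto
    finally show ?case by (simp add: mult.commute)
  qed
  then show ?thesis by (rule bigoI)
qed


section \<open>Real zeros of \<open>Re (C (z - i)\<^sup>n)\<close>\<close>

lemma real_minus_ii_polar:
  fixes z :: real
  shows "of_real z - \<i> = of_real (sqrt (1 + z\<^sup>2)) * (- \<i> * cis (arctan z))"
proof -
  have "sqrt (1 + z\<^sup>2) \<noteq> 0"
    by (smt (verit) real_sqrt_eq_zero_cancel_iff zero_le_power2)
  then show ?thesis
    by (simp add: complex_eq_iff cos_arctan sin_arctan)
qed

text \<open>
  By the polar form of \<open>z - i\<close> and de Moivre's formula, the angle \<open>arctan z\<close> turns the polynomial
  into a positive multiple of a cosine of frequency \<open>n\<close>.
\<close>

lemma nodal_zero_iff_cos:
  fixes z :: real
  assumes "C \<noteq> 0"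
  shows "Re (C * (of_real z - \<i>) ^ n) = 0 \<longleftrightarrow> cos (Arg (C * (- \<i>) ^ n) + real n * arctan z) = 0"
proof -
  define E where "E = C * (- \<i>) ^ n"
  define r where "r = sqrt (1 + z\<^sup>2) ^ n * cmod E"
  have "sqrt (1 + z\<^sup>2) > 0"
    by (smt (verit) real_sqrt_gt_zero zero_le_power2)
  then have "r \<noteq> 0" using assms by (simp add: r_def E_def)
  have "C * (of_real z - \<i>) ^ n = of_real (sqrt (1 + z\<^sup>2) ^ n) * (E * cis (real n * arctan z))"
    unfolding real_minus_ii_polar power_mult_distrib E_def Complex.DeMoivre
    by (simp add: mult_ac power_mult_distrib[symmetric])
  also have "E = of_real (cmod E) * cis (Arg E)"
    by (metis rcis_cmod_Arg rcis_def)
  finally have "C * (of_real z - \<i>) ^ n = of_real r * cis (Arg E + real n * arctan z)"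
    by (simp add: r_def cis_mult[symmetric] mult_ac)
  then show ?thesis
    using \<open>r \<noteq> 0\<close> by (simp add: E_def)
qed

lemma cos_zeros_gap:
  fixes a b :: real
  assumes "cos a = 0" "cos b = 0" "a < b"
  shows "pi \<le> b - a"
proof (rule ccontr)
  assume "\<not> pi \<le> b - a"
  then have "sin (b - a) > 0"
    using assms by (intro sin_gt_zero) auto
  then show False
    using assms by (simp add: sin_diff)
qed

lemma nodal_zeros_gap:
  fixes z z' :: real
  assumes "C \<noteq> 0" "n > 0" "z < z'"
    and "Re (C * (of_real z - \<i>) ^ n) = 0" "Re (C * (of_real z' - \<i>) ^ n) = 0"
  shows "pi \<le> real n * (arctan z' - arctan z)"
proof -
  have "arctan z < arctan z'" using assms by (simp add: arctan_less_iff)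
  then show ?thesis
    using cos_zeros_gap[of "Arg (C * (- \<i>) ^ n) + real n * arctan z"
        "Arg (C * (- \<i>) ^ n) + real n * arctan z'"] assms
    unfolding nodal_zero_iff_cos[OF \<open>C \<noteq> 0\<close>] by (simp add: right_diff_distrib)
qed

text \<open>
  Otherwise the next point \<open>arctan z + \<pi>/n\<close> of the grid lies before \<open>arctan z'\<close>, and hence is
  the angle of a real zero strictly between \<open>z\<close> and \<open>z'\<close>.
\<close>

lemma nodal_consecutive_zeros_gap:
  fixes z z' :: real
  assumes "C \<noteq> 0" "n > 0" "z < z'"
    and z: "Re (C * (of_real z - \<i>) ^ n) = 0"
    and between: "\<And>y. z < y \<Longrightarrow> y < z' \<Longrightarrow> Re (C * (of_real y - \<i>) ^ n) \<noteq> 0"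
  shows "real n * (arctan z' - arctan z) \<le> pi"
proof (rule ccontr)
  assume *: "\<not> real n * (arctan z' - arctan z) \<le> pi"
  define t where "t = arctan z + pi / real n"
  have "t < arctan z'"
    using * \<open>n > 0\<close> by (simp add: t_def field_simps)
  moreover have "arctan z < t"
    using \<open>n > 0\<close> by (simp add: t_def)
  ultimately have t: "arctan (tan t) = t"
    using arctan_bounded[of z] arctan_bounded[of z'] by (intro arctan_tan) linarith+
  have "z < tan t" "tan t < z'"
    using t \<open>arctan z < t\<close> \<open>t < arctan z'\<close> arctan_less_iff by metis+
  moreover have "Arg (C * (- \<i>) ^ n) + real n * t = Arg (C * (- \<i>) ^ n) + real n * arctan z + pi"
    using \<open>n > 0\<close> by (simp add: t_def field_simps)
  then have "Re (C * (of_real (tan t) - \<i>) ^ n) = 0"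
    using z t unfolding nodal_zero_iff_cos[OF \<open>C \<noteq> 0\<close>] by (simp add: cos_add sin_add)
  ultimately show False
    using between by blast
qed

text \<open>
  The \<open>m - 1\<close> gaps between the angles, each at least \<open>\<pi>/n\<close>, fit into an open interval of
  length \<open>\<pi>\<close>.
\<close>

lemma nodal_zeros_le:
  fixes \<alpha> :: "nat \<Rightarrow> real"
  assumes "C \<noteq> 0" "n > 0" "strict_mono_on {1..m} \<alpha>"
    and zeros: "\<And>k. k \<in> {1..m} \<Longrightarrow> Re (C * (of_real (\<alpha> k) - \<i>) ^ n) = 0"
  shows "m \<le> n"
proof (cases "m = 0")
  case False
  have "real k * pi \<le> real n * (arctan (\<alpha> (Suc k)) - arctan (\<alpha> 1))" if "k < m" for k
    using that
  proof (induction k)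
    case (Suc k)
    have "\<alpha> (Suc k) < \<alpha> (Suc (Suc k))"
      using Suc.prems by (intro strict_mono_onD[OF assms(3)]) auto
    then have "pi \<le> real n * (arctan (\<alpha> (Suc (Suc k))) - arctan (\<alpha> (Suc k)))"
      using Suc.prems by (intro nodal_zeros_gap[OF assms(1,2)] zeros) auto
    with Suc show ?case by (simp add: algebra_simps)
  qed simp
  from this[of "m - 1"] False have "real (m - 1) * pi \<le> real n * (arctan (\<alpha> m) - arctan (\<alpha> 1))"
    by simp
  also have "\<dots> < real n * pi"
    using arctan_bounded[of "\<alpha> m"] arctan_bounded[of "\<alpha> 1"] \<open>n > 0\<close>
    by (intro mult_strict_left_mono) auto
  finally show ?thesis by simp
qed simp

section \<open>The pencil polynomials as real and imaginary part of \<open>(z - i)\<^sup>l\<close>\<close>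

lemma binomial_Suc_ratio: "real (Suc k) * real (n choose Suc k) = (real n - real k) * real (n choose k)"
proof (cases "k \<le> n")
  case True
  have "Suc k * (n choose Suc k) = (n - k) * (n choose k)"
    by (simp only: binomial_absorb_comp binomial_absorption)
  then show ?thesis
    using True by (metis of_nat_diff of_nat_mult)
qed (simp add: binomial_eq_0)

text \<open>
  With \<open>k = l - 2(j+1)\<close>, the denominator \<open>(k + \<lambda>)(k + \<lambda> + 1)\<close> of the recursion is
  \<open>(2j+2)(2j+1)\<close> for \<open>\<lambda> = -l\<close>. Thus two steps in the binomial coefficient make up one step of
  the recursion, and its sign is the one of \<open>i\<^sup>2\<close>.
\<close>

lemma pencil_coeff_psi1:
  "pencil_coeff (- real l) l j = (-1) ^ j * real (l choose (2 * j))"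
proof (induction j)
  case (Suc j)
  define x where "x = real l - 2 * real j"
  have "(2 * real j + 2) * real (l choose (2 * j + 2)) = (x - 1) * real (l choose (2 * j + 1))"
    using binomial_Suc_ratio[of "2 * j + 1" l] by (simp add: x_def algebra_simps)
  moreover have "(2 * real j + 1) * real (l choose (2 * j + 1)) = x * real (l choose (2 * j))"
    using binomial_Suc_ratio[of "2 * j" l] by (simp add: x_def algebra_simps)
  ultimately have ratio: "(2 * real j + 2) * (2 * real j + 1) * real (l choose (2 * j + 2))
      = x * (x - 1) * real (l choose (2 * j))"
    by algebra
  define k where "k = real l - 2 * real (Suc j)"
  have k: "k + 2 = x" "k + 1 = x - 1"
    by (simp_all add: k_def x_def)
  have den: "k * (k - 1) + 2 * (- real l + 1) * k + (- real l) * (- real l + 1)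
      = (2 * real j + 2) * (2 * real j + 1)"
    by (simp add: k_def algebra_simps)
  have "pencil_coeff (- real l) l (Suc j)
      = - (x * (x - 1)) / ((2 * real j + 2) * (2 * real j + 1)) * pencil_coeff (- real l) l j"
    unfolding pencil_coeff.simps Let_def k_def[symmetric] k den ..
  also have "\<dots> = (-1) ^ Suc j * (x * (x - 1) * real (l choose (2 * j)))
      / ((2 * real j + 2) * (2 * real j + 1))"
    by (simp add: Suc)
  also have "\<dots> = (-1) ^ Suc j * real (l choose (2 * j + 2))"
    unfolding ratio[symmetric] by (simp add: add_nonneg_eq_0_iff)
  finally show ?case by simp
qed simp

text \<open>
  The odd binomial coefficients of \<open>(z - i)\<^bsup>n+1\<^esup>\<close> start with \<open>n + 1\<close>, while the
  eigenfunction is monic; this explains the factor on the left.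
\<close>

lemma pencil_coeff_psi2:
  "real (Suc n) * pencil_coeff (- real n - 1) n j = (-1) ^ j * real (Suc n choose (2 * j + 1))"
proof (induction j)
  case (Suc j)
  define x where "x = real n - 2 * real j"
  have "(2 * real j + 3) * real (Suc n choose (2 * j + 3)) = (x - 1) * real (Suc n choose (2 * j + 2))"
    using binomial_Suc_ratio[of "2 * j + 2" "Suc n"]
    by (simp add: x_def algebra_simps numeral_3_eq_3 del: binomial_Suc_Suc)
  moreover have "(2 * real j + 2) * real (Suc n choose (2 * j + 2)) = x * real (Suc n choose (2 * j + 1))"
    using binomial_Suc_ratio[of "2 * j + 1" "Suc n"]
    by (simp add: x_def algebra_simps del: binomial_Suc_Suc)
  ultimately have ratio: "(2 * real j + 3) * (2 * real j + 2) * real (Suc n choose (2 * j + 3))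
      = x * (x - 1) * real (Suc n choose (2 * j + 1))"
    by algebra
  define k where "k = real n - 2 * real (Suc j)"
  have k: "k + 2 = x" "k + 1 = x - 1"
    by (simp_all add: k_def x_def)
  have den: "k * (k - 1) + 2 * (- real n - 1 + 1) * k + (- real n - 1) * (- real n - 1 + 1)
      = (2 * real j + 3) * (2 * real j + 2)"
    by (simp add: k_def algebra_simps)
  have "pencil_coeff (- real n - 1) n (Suc j)
      = - (x * (x - 1)) / ((2 * real j + 3) * (2 * real j + 2)) * pencil_coeff (- real n - 1) n j"
    unfolding pencil_coeff.simps Let_def k_def[symmetric] k den ..
  then have "real (Suc n) * pencil_coeff (- real n - 1) n (Suc j)
      = - (x * (x - 1)) / ((2 * real j + 3) * (2 * real j + 2))
          * (real (Suc n) * pencil_coeff (- real n - 1) n j)"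
    by (simp only: mult_ac)
  also have "\<dots> = (-1) ^ Suc j * (x * (x - 1) * real (Suc n choose (2 * j + 1)))
      / ((2 * real j + 3) * (2 * real j + 2))"
    unfolding Suc by simp
  also have "\<dots> = (-1) ^ Suc j * real (Suc n choose (2 * j + 3))"
    unfolding ratio[symmetric] by (simp add: add_nonneg_eq_0_iff)
  finally show ?case by (simp add: numeral_3_eq_3)
qed simp

lemma neg_ii_power:
  "(- \<i>) ^ (2 * j) = (-1) ^ j" "(- \<i>) ^ (2 * j + 1) = - \<i> * (-1) ^ j"
  by (simp_all add: power_mult)

lemma sum_even_odd:
  fixes f :: "nat \<Rightarrow> 'a::comm_monoid_add"
  shows "(\<Sum>k\<le>n. f k) = (\<Sum>j\<le>n div 2. f (2 * j)) + (\<Sum>j<(n+1) div 2. f (2 * j + 1))"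
proof (induction n)
  case (Suc n)
  show ?case
  proof (cases "even n")
    case True
    then obtain q where "n = 2 * q" by blast
    then show ?thesis using Suc by (simp add: add_ac)
  next
    case False
    then obtain q where "n = 2 * q + 1" using oddE by blast
    then show ?thesis using Suc by (simp add: add_ac)
  qed
qed simp

lemma real_minus_ii_power:
  fixes z :: real
  shows "(of_real z - \<i>) ^ Suc n
           = of_real (poly (psi1 (Suc n)) z) - \<i> * of_real (real (Suc n) * poly (psi2 n) z)"
proof -
  let ?t = "\<lambda>k. of_nat (Suc n choose k) * (- \<i>) ^ k * of_real z ^ (Suc n - k)"
  have "(of_real z - \<i>) ^ Suc n = (\<Sum>k\<le>Suc n. ?t k)"
    using binomial_ring[of "- \<i>" "of_real z" "Suc n"] by simp
  also have "\<dots> = (\<Sum>j\<le>Suc n div 2. ?t (2 * j)) + (\<Sum>j<(Suc n + 1) div 2. ?t (2 * j + 1))"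
    by (rule sum_even_odd)
  also have "{..<(Suc n + 1) div 2} = {..n div 2}"
    by (simp add: lessThan_Suc_atMost)
  also have "(\<Sum>j\<le>Suc n div 2. ?t (2 * j)) = of_real (poly (psi1 (Suc n)) z)"
    unfolding psi1_def pencil_poly_def poly_sum poly_monom of_real_sum pencil_coeff_psi1 neg_ii_power
    by (intro sum.cong refl) simp
  also have "(\<Sum>j\<le>n div 2. ?t (2 * j + 1)) = - \<i> * of_real (real (Suc n) * poly (psi2 n) z)"
    unfolding psi2_def pencil_poly_def poly_sum poly_monom of_real_sum neg_ii_power
      sum_distrib_left mult.assoc[symmetric] pencil_coeff_psi2
    by (intro sum.cong refl) simp
  finally show ?thesis by simp
qed

text \<open>
  The division by \<open>l\<close> undoes the normalisation of \<open>psi2\<close>; real pairs \<open>(c, d)\<close> and complex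
  constants thus correspond to each other, non-trivial ones to non-zero ones.
\<close>

lemma poly_psi_comb:
  fixes z :: real
  assumes "l > 0"
  shows "poly (psi_comb l c d) z = Re (Complex c (d / real l) * (of_real z - \<i>) ^ l)"
proof -
  obtain n where "l = Suc n" using assms gr0_implies_Suc by blast
  then show ?thesis
    unfolding psi_comb_def by (simp only: real_minus_ii_power) simp
qed
section \<open>The multiple crack problem\<close>

theorem theorem3p2:
  fixes \<Omega> :: "(real \<times> real) set"
    and \<Gamma> :: "nat \<Rightarrow> (real \<times> real) set"
    and \<alpha> :: "nat \<Rightarrow> real"
    and m :: nat
  assumes domain: "bounded_smooth_domain \<Omega>" "(0, 0) \<in> \<Omega>"
    and m: "m \<ge> 1"
    and cracks: "\<And>k. k \<in> {1..m} \<Longrightarrow> is_curve (\<Gamma> k) \<and> \<Gamma> k \<subseteq> \<Omega> \<and> (0, 0) \<in> \<Gamma> k"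
    and asymptotics: "\<And>k. k \<in> {1..m} \<Longrightarrow> asymptotic_line_below (\<Gamma> k) (\<alpha> k)"
    and ordered: "strict_mono_on {1..m} \<alpha>"
  shows
    "((\<forall>l\<ge>m. \<not> coincide_with_zeros m \<alpha> l) \<longrightarrow>
        (\<forall>f. (\<exists>p\<in>frontier \<Omega>. f p \<noteq> 0) \<longrightarrow>
             \<not> (\<exists>u. crack_solution \<Omega> (\<Union>k\<in>{1..m}. \<Gamma> k) f u))) \<and>
     (\<forall>l\<ge>m. \<forall>f u.
        (coincide_with_zeros m \<alpha> l \<and> (\<forall>l'\<in>{m..<l}. \<not> coincide_with_zeros m \<alpha> l') \<or>
         m \<ge> 2 \<and> coincide_with_consecutive_zeros m \<alpha> l) \<and>
        (\<exists>p\<in>frontier \<Omega>. f p \<noteq> 0) \<and> crack_solution \<Omega> (\<Union>k\<in>{1..m}. \<Gamma> k) f u \<longrightarrow>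
        u \<in> O[at (0, 0)](\<lambda>p. norm p ^ l))"
proof -
  have \<Omega>: "open \<Omega>" "connected \<Omega>"
    using domain by (auto simp: bounded_smooth_domain_def)
  have key: "\<exists>N C. m \<le> N \<and> C \<noteq> 0 \<and> (\<forall>k\<in>{1..m}. Re (C * (of_real (\<alpha> k) - \<i>) ^ N) = 0) \<and>
      coincide_with_zeros m \<alpha> N \<and> (\<forall>l\<le>N. u \<in> O[at (0, 0)](\<lambda>p. norm p ^ l))"
    if f: "\<exists>p\<in>frontier \<Omega>. f p \<noteq> 0" and sol: "crack_solution \<Omega> (\<Union>k\<in>{1..m}. \<Gamma> k) f u" for f u
  proof -
    have u: "continuous_on (closure \<Omega>) u" "Ck_on 2 u \<Omega>" "\<forall>p\<in>\<Omega>. laplacian u p = 0"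
      "\<And>p. p \<in> frontier \<Omega> \<Longrightarrow> u p = f p" "\<And>k p. k \<in> {1..m} \<Longrightarrow> p \<in> \<Gamma> k \<Longrightarrow> u p = 0"
      using sol by (auto simp: crack_solution_def)
    have u0: "u (0, 0) = 0"
      using u(5)[of 1 "(0, 0)"] cracks[of 1] m by auto
    \<comment> \<open>A solution that vanishes in \<open>\<Omega>\<close> vanishes on the boundary as well, by continuity.\<close>
    have nz: "\<exists>p\<in>\<Omega>. u p \<noteq> 0"
    proof (rule ccontr)
      assume "\<not> (\<exists>p\<in>\<Omega>. u p \<noteq> 0)"
      then have "u p = 0" if "p \<in> closure \<Omega>" for p
        using continuous_constant_on_closure[OF u(1), of 0] that by blast
      then show False
        using f u(4) by (auto simp: frontier_def)
    qed
    obtain N r h where N: "N > 0" "r > 0" "h holomorphic_on ball 0 r" "h 0 \<noteq> 0"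
      "\<And>w. w \<in> ball 0 r \<Longrightarrow> u (Re w, Im w) = Re (w ^ N * h w)"
      using harmonic_local_factorization[OF \<Omega> domain(2) u(2,3) u0 nz] by metis
    have zeros: "Re (h 0 * (of_real (\<alpha> k) - \<i>) ^ N) = 0" if "k \<in> {1..m}" for k
      using N(2,3,5) asymptotics[OF that] u(5)[OF that] by (rule nodal_direction_zero)
    have "m \<le> N"
      using N(4,1) ordered zeros by (rule nodal_zeros_le)
    moreover have "coincide_with_zeros m \<alpha> N"
      unfolding coincide_with_zeros_def
    proof (intro exI conjI ballI)
      show "(Re (h 0))\<^sup>2 + (real N * Im (h 0))\<^sup>2 \<noteq> 0"
        using N(1,4) by (simp add: sum_power2_eq_zero_iff complex_eq_iff)
      show "poly (psi_comb N (Re (h 0)) (real N * Im (h 0))) (\<alpha> k) = 0" if "k \<in> {1..m}" for k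
        using zeros[OF that] N(1) by (simp only: poly_psi_comb) simp
    qed
    ultimately show ?thesis
      using N zeros factorization_bigo[OF N(2,3,5)] by blast
  qed
  \<comment> \<open>The angles of \<open>\<alpha> 1\<close> and \<open>\<alpha> 2\<close> differ by at most \<open>\<pi>/l\<close> and by at least \<open>\<pi>/N\<close>.\<close>
  have order: "l \<le> N"
    if N: "m \<le> N" "C \<noteq> 0" "\<forall>k\<in>{1..m}. Re (C * (of_real (\<alpha> k) - \<i>) ^ N) = 0"
      and l: "m \<le> l" "m \<ge> 2" "coincide_with_consecutive_zeros m \<alpha> l" for N C l
  proof -
    obtain c d where cd: "c\<^sup>2 + d\<^sup>2 \<noteq> 0" "\<forall>k\<in>{1..m}. poly (psi_comb l c d) (\<alpha> k) = 0"
      "\<forall>k\<in>{1..<m}. \<forall>z. \<alpha> k < z \<and> z < \<alpha> (Suc k) \<longrightarrow> poly (psi_comb l c d) z \<noteq> 0"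
      using l(3) by (auto simp: coincide_with_consecutive_zeros_def)
    have "l > 0" "N > 0" using l m N by linarith+
    have \<alpha>: "\<alpha> 1 < \<alpha> 2"
      using l(2) by (intro strict_mono_onD[OF ordered]) auto
    have "real l * (arctan (\<alpha> 2) - arctan (\<alpha> 1)) \<le> pi"
    proof (rule nodal_consecutive_zeros_gap[of "Complex c (d / real l)"])
      show "Complex c (d / real l) \<noteq> 0"
        using cd(1) \<open>l > 0\<close> by (auto simp: complex_eq_iff)
      show "Re (Complex c (d / real l) * (of_real (\<alpha> 1) - \<i>) ^ l) = 0"
        using cd(2) l(2) by (simp only: poly_psi_comb[OF \<open>l > 0\<close>, symmetric]) simp
      show "Re (Complex c (d / real l) * (of_real z - \<i>) ^ l) \<noteq> 0" if "\<alpha> 1 < z" "z < \<alpha> 2" for z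
        using cd(3)[rule_format, of 1 z] that l(2)
        by (simp only: poly_psi_comb[OF \<open>l > 0\<close>, symmetric]) (simp add: numeral_2_eq_2)
    qed (use \<open>l > 0\<close> \<alpha> in auto)
    also have "pi \<le> real N * (arctan (\<alpha> 2) - arctan (\<alpha> 1))"
      using N l(2) \<open>N > 0\<close> \<alpha> by (intro nodal_zeros_gap) auto
    finally show "l \<le> N"
      using \<alpha> by (simp add: arctan_less_iff)
  qed
  show ?thesis
  proof (intro conjI impI allI notI; (elim conjE exE)?)
    fix f u
    assume "\<forall>l\<ge>m. \<not> coincide_with_zeros m \<alpha> l" "\<exists>p\<in>frontier \<Omega>. f p \<noteq> 0"
      "crack_solution \<Omega> (\<Union>k\<in>{1..m}. \<Gamma> k) f u"
    then show False using key by blast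
  next
    fix l f u
    assume l: "m \<le> l"
      and coincide: "coincide_with_zeros m \<alpha> l \<and> (\<forall>l'\<in>{m..<l}. \<not> coincide_with_zeros m \<alpha> l') \<or>
         m \<ge> 2 \<and> coincide_with_consecutive_zeros m \<alpha> l"
      and "\<exists>p\<in>frontier \<Omega>. f p \<noteq> 0" "crack_solution \<Omega> (\<Union>k\<in>{1..m}. \<Gamma> k) f u"
    then obtain N C where N: "m \<le> N" "C \<noteq> 0" "\<forall>k\<in>{1..m}. Re (C * (of_real (\<alpha> k) - \<i>) ^ N) = 0"
      "coincide_with_zeros m \<alpha> N" "\<forall>l\<le>N. u \<in> O[at (0, 0)](\<lambda>p. norm p ^ l)"
      using key by blast
    have "l \<le> N"
      using coincide
    proof
      assume "coincide_with_zeros m \<alpha> l \<and> (\<forall>l'\<in>{m..<l}. \<not> coincide_with_zeros m \<alpha> l')"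
      then show ?thesis using N(1,4) by (meson atLeastLessThan_iff not_le)
    next
      assume "m \<ge> 2 \<and> coincide_with_consecutive_zeros m \<alpha> l"
      then show ?thesis using order N(1-3) l by blast
    qed
    then show "u \<in> O[at (0, 0)](\<lambda>p. norm p ^ l)"
      using N(5) by blast
  qed
qed

end
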